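(* Let $\mathcal{P}$ be a poset on a finite set $I$ and let $I=S\sqcup T$. If $\eta\in\mathrm{NN}(\mathcal{P},q)$, then $$\Delta_{\mathcal{P}|_S,\mathcal{P}|_T}(\kappa_\eta)=\sum_{\substack{\nu\in\mathrm{NN}(\mathcal{P}|_S,q)\\ \rho\in\mathrm{NN}(\mathcal{P}|_T,q)\\ \mathrm{sml}(\nu\sqcup\rho)=\eta}}\kappa_\nu\otimes\kappa_\rho.$$
   Context: $\mathbb{F}_q$ is the field with $q$ elements. For a poset $\mathcal{P}$ on a finite set $I$, the pattern group $U_\mathcal{P}$ is the group of matrices $g=1+x$, where $x=(x_{ij})_{i,j\in I}$ over $\mathbb{F}_q$ has $x_{ij}=0$ unless $i\prec_\mathcal{P}j$. $\mathcal{P}|_S$ is the restriction of $\mathcal{P}$ to $S\subseteq I$. An $(\mathbb{F}_q,\mathcal{P})$-set partition is a set $\eta$ of labeled arcs $i\overset{a}{\frown}j$ ($i,j\in I$, $a\in\mathbb{F}_q^\times$, at most one label for each pair) such that (1) $i\prec_\mathcal{P}j$ for every arc; (2) if $i\overset{a}{\frown}j\in\eta$ and $i\prec_\mathcal{P}k\prec_\mathcal{P}j$, then $\eta$ has no arc from $i$ to $k$ and none from $k$ to $j$ (with any label). It is nonnesting if there are no arcs $i\overset{a}{\frown}j,k\overset{b}{\frown}l\in\eta$ with $i\prec_\mathcal{P}k\prec_\mathcal{P}l\prec_\mathcal{P}j$. $\mathrm{NN}(\mathcal{P},q)$ is the set of nonnesting $(\mathbb{F}_q,\mathcal{P})$-set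 partitions. If $I=S\sqcup T$, $\nu$ is an $(\mathbb{F}_q,\mathcal{P}|_S)$-set partition and $\rho$ an $(\mathbb{F}_q,\mathcal{P}|_T)$-set partition, $\nu\sqcup\rho$ is the $(\mathbb{F}_q,\mathcal{P})$-set partition whose arc set is the union of those of $\nu$ and $\rho$. For an $(\mathbb{F}_q,\mathcal{P})$-set partition $\eta$, $\mathrm{sml}(\eta)=\{i\overset{a}{\frown}j\in\eta\mid\text{there are no }k\overset{b}{\frown}l\in\eta\text{ with }i\prec_\mathcal{P}k\prec_\mathcal{P}l\prec_\mathcal{P}j\}$, which is nonnesting. For $g\in U_\mathcal{P}$, $\mathrm{sml}(g)\in\mathrm{NN}(\mathcal{P},q)$ is the set of arcs $i\overset{g_{ij}}{\frown}j$ with $i\prec_\mathcal{P}j$, $g_{ij}\neq0$, and $g_{kl}=0$ whenever $(k,l)\neq(i,j)$ and $i\preceq_\mathcal{P}k\prec_\mathcal{P}l\preceq_\mathcal{P}j$. For $\eta\in\mathrm{NN}(\mathcal{P},q)$, $K_\eta=\{g\in U_\mathcal{P}\mid\mathrm{sml}(g)=\eta\}$ and $\kappa_\eta:U_\mathcal{P}\to\mathbb{C}$ is the indicator function of $K_\eta$. $\sigma_{\mathcal{P}|_S,\mathcal{P}|_T}:U_{\mathcal{P}|_S}\times U_{\mathcal{P}|_T}\to U_\mathcal{P}$ sends $(g,h)$ to the matrix with entries $g_{ij}$ if $i,j\in S$, $h_{ij}$ if $i,j\in T$, and $0$ otherwise. For $\alpha:U_\mathcal{P}\to\mathbb{C}$,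 $\Delta_{\mathcal{P}|_S,\mathcal{P}|_T}(\alpha)=\alpha\circ\sigma_{\mathcal{P}|_S,\mathcal{P}|_T}$, a function on $U_{\mathcal{P}|_S}\times U_{\mathcal{P}|_T}$ regarded as an element of the tensor product of the function spaces on $U_{\mathcal{P}|_S}$ and $U_{\mathcal{P}|_T}$ via $(\alpha\otimes\beta)(g,h)=\alpha(g)\beta(h)$. *)

theory Defs
  imports Complex_Main "HOL-Algebra.Group" "HOL-Library.Indicator_Function"
    "HOL-Library.Function_Algebras"
begin

text \<open>
  A poset on a set \<open>I\<close> is given by its reflexive order relation \<open>P\<close>, with
  \<^term>\<open>partial_order_on I P\<close>; its restriction to \<open>S \<subseteq> I\<close> is \<^term>\<open>Restr P S\<close>.
  The finite field is a type of class \<open>field\<close> and \<open>finite\<close>.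
\<close>

definition prec :: "'a rel \<Rightarrow> 'a \<Rightarrow> 'a \<Rightarrow> bool" where
  "prec P i j \<longleftrightarrow> (i, j) \<in> P \<and> i \<noteq> j"

subsection \<open>Pattern groups\<close>

text \<open>An \<open>I \<times> I\<close> matrix is a function on pairs of indices that vanishes outside \<open>I \<times> I\<close>,
  so that equality of matrices is equality of functions.\<close>

type_synonym ('a, 'f) matr = "'a \<Rightarrow> 'a \<Rightarrow> 'f"

definition id_matr :: "'a set \<Rightarrow> ('a, 'f::field) matr" where
  "id_matr I = (\<lambda>i j. if i \<in> I \<and> i = j then 1 else 0)"

definition mult_matr :: "'a set \<Rightarrow> ('a, 'f::field) matr \<Rightarrow> ('a, 'f) matr \<Rightarrow> ('a, 'f) matr" where
  "mult_matr I g h = (\<lambda>i j. \<Sum>k\<in>I. g i k * h k j)"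

definition pattern_group :: "'a set \<Rightarrow> 'a rel \<Rightarrow> ('a, 'f::field) matr monoid" where
  "pattern_group I P =
     \<lparr>carrier = {g. \<exists>x. (\<forall>i j. \<not> prec P i j \<longrightarrow> x i j = 0) \<and> g = (\<lambda>i j. id_matr I i j + x i j)},
      mult = mult_matr I,
      one = id_matr I\<rparr>"

abbreviation U :: "'a set \<Rightarrow> 'a rel \<Rightarrow> ('a, 'f::field) matr set" where
  "U I P \<equiv> carrier (pattern_group I P)"

lemma mem_U_iff:
  assumes "partial_order_on I P"
  shows "g \<in> U I P \<longleftrightarrow> (\<forall>i\<in>I. g i i = 1) \<and> (\<forall>i j. (i, j) \<notin> P \<longrightarrow> g i j = 0)"
proof
  assume "g \<in> U I P"
  with assms show "(\<forall>i\<in>I. g i i = 1) \<and> (\<forall>i j. (i, j) \<notin> P \<longrightarrow> g i j = 0)"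
    by (auto simp: pattern_group_def id_matr_def prec_def partial_order_on_def preorder_on_def
        refl_on_def)
next
  assume *: "(\<forall>i\<in>I. g i i = 1) \<and> (\<forall>i j. (i, j) \<notin> P \<longrightarrow> g i j = 0)"
  have "P \<subseteq> I \<times> I"
    using assms by (auto simp: partial_order_on_def preorder_on_def)
  with * have "(\<forall>i j. \<not> prec P i j \<longrightarrow> g i j - id_matr I i j = 0)
      \<and> g = (\<lambda>i j. id_matr I i j + (g i j - id_matr I i j))"
    by (auto simp: id_matr_def prec_def)
  then show "g \<in> U I P"
    unfolding pattern_group_def by (auto intro!: exI[of _ "\<lambda>i j. g i j - id_matr I i j"])
qed

lemma finite_U:
  assumes "finite I" "partial_order_on I P"
  shows "finite (U I P :: ('a, 'f::{field,finite}) matr set)"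
proof -
  let ?F = "{f :: 'a \<times> 'a \<Rightarrow> 'f. \<forall>x. (x \<in> I \<times> I \<longrightarrow> f x \<in> UNIV) \<and> (x \<notin> I \<times> I \<longrightarrow> f x = 0)}"
  have "P \<subseteq> I \<times> I"
    using assms by (auto simp: partial_order_on_def preorder_on_def)
  have "(U I P :: ('a, 'f) matr set) \<subseteq> curry ` ?F"
  proof
    fix g :: "('a, 'f) matr"
    assume "g \<in> U I P"
    with \<open>P \<subseteq> I \<times> I\<close> have "case_prod g \<in> ?F"
      by (auto simp: mem_U_iff[OF assms(2)])
    then have "curry (case_prod g) \<in> curry ` ?F"
      by (rule imageI)
    then show "g \<in> curry ` ?F"
      by (simp only: curry_case_prod)
  qed
  moreover have "finite ?F"
    using assms(1) by (intro finite_set_of_finite_funs) auto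
  ultimately show ?thesis
    by (meson finite_imageI finite_subset)
qed

lemma group_pattern_group:
  assumes fin: "finite I" and po: "partial_order_on I P"
  shows "group (pattern_group I P :: ('a, 'f::{field,finite}) matr monoid)"
proof -
  let ?G = "pattern_group I P :: ('a, 'f) matr monoid"
  have sub: "P \<subseteq> I \<times> I" and tr: "\<And>i j k. (i, j) \<in> P \<Longrightarrow> (j, k) \<in> P \<Longrightarrow> (i, k) \<in> P"
    and an: "\<And>i j. (i, j) \<in> P \<Longrightarrow> (j, i) \<in> P \<Longrightarrow> i = j"
    and re: "\<And>i. i \<in> I \<Longrightarrow> (i, i) \<in> P"
    using po by (auto simp: partial_order_on_def preorder_on_def trans_def antisym_def refl_on_def)
  note mem = mem_U_iff[OF po]
  have m: "g \<otimes>\<^bsub>?G\<^esub> h = mult_matr I g h" and o: "\<one>\<^bsub>?G\<^esub> = id_matr I" for g h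
    by (simp_all add: pattern_group_def)
  have diag: "mult_matr I g h i i = 1" if g: "g \<in> U I P" and h: "h \<in> U I P" and i: "i \<in> I"
    for g h :: "('a, 'f) matr" and i
  proof -
    have "mult_matr I g h i i = (\<Sum>k\<in>I. if k = i then 1 else 0)"
      unfolding mult_matr_def
    proof (rule sum.cong)
      fix k assume "k \<in> I"
      have "g i k * h k i = 0" if "k \<noteq> i"
        using that an[of i k] g h by (cases "(i, k) \<in> P"; cases "(k, i) \<in> P") (auto simp: mem)
      then show "g i k * h k i = (if k = i then 1 else 0)"
        using g h i by (auto simp: mem)
    qed simp
    then show ?thesis using fin i by simp
  qed
  have closed: "mult_matr I g h \<in> U I P" if g: "g \<in> U I P" and h: "h \<in> U I P"
    for g h :: "('a, 'f) matr"
  proof -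
    have "mult_matr I g h i j = 0" if "(i, j) \<notin> P" for i j
      unfolding mult_matr_def
    proof (rule sum.neutral, rule ballI)
      fix k
      show "g i k * h k j = 0"
        using that tr[of i k j] g h by (cases "(i, k) \<in> P"; cases "(k, j) \<in> P") (auto simp: mem)
    qed
    with diag[OF g h] show ?thesis by (simp add: mem)
  qed
  have one: "id_matr I \<in> (U I P :: ('a, 'f) matr set)"
    using re by (auto simp: mem id_matr_def)
  have outside: "g i j = 0" if "g \<in> U I P" "i \<notin> I \<or> j \<notin> I" for g :: "('a, 'f) matr" and i j
    using that sub by (auto simp: mem)
  have assoc: "mult_matr I (mult_matr I a b) c = mult_matr I a (mult_matr I b c)"
    for a b c :: "('a, 'f) matr"
  proof (intro ext)
    fix i j
    show "mult_matr I (mult_matr I a b) c i j = mult_matr I a (mult_matr I b c) i j"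
      unfolding mult_matr_def sum_distrib_left sum_distrib_right
      by (subst sum.swap) (simp add: mult.assoc)
  qed
  have l_one: "mult_matr I (id_matr I) g = g" if "g \<in> U I P" for g :: "('a, 'f) matr"
  proof (intro ext)
    fix i j
    have "mult_matr I (id_matr I) g i j = (\<Sum>k\<in>I. if k = i then g i j else 0)"
      unfolding mult_matr_def id_matr_def by (rule sum.cong) auto
    then show "mult_matr I (id_matr I) g i j = g i j"
      using fin outside[OF that, of i j] by auto
  qed
  have wf: "wf (P - Id)"
  proof (rule finite_acyclic_wf)
    show "finite (P - Id)"
      using sub fin by (meson finite_Diff finite_SigmaI finite_subset)
    have "trans (P - Id)"
      using tr an by (auto simp: trans_def)
    then show "acyclic (P - Id)"
      by (simp add: acyclic_def trancl_id)
  qed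
  have inj: "inj_on (\<lambda>h. mult_matr I h g) (U I P)" if g: "g \<in> U I P" for g :: "('a, 'f) matr"
  proof (rule inj_onI)
    fix h h' :: "('a, 'f) matr"
    assume h: "h \<in> U I P" and h': "h' \<in> U I P" and eq: "mult_matr I h g = mult_matr I h' g"
    have "h i j = h' i j" for i j
    proof (induction j rule: wf_induct_rule[OF wf])
      case (1 j)
      show ?case
      proof (cases "j \<in> I")
        case True
        have split: "mult_matr I a g i j = a i j + (\<Sum>k\<in>I - {j}. a i k * g k j)"
          for a :: "('a, 'f) matr"
          using fin True g by (simp add: mult_matr_def sum.remove[of I j] mem)
        have "(\<Sum>k\<in>I - {j}. h i k * g k j) = (\<Sum>k\<in>I - {j}. h' i k * g k j)"
        proof (rule sum.cong)
          fix k assume "k \<in> I - {j}"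
          then show "h i k * g k j = h' i k * g k j"
            using "1" g by (cases "(k, j) \<in> P") (auto simp: mem)
        qed simp
        moreover have "mult_matr I h g i j = mult_matr I h' g i j"
          using eq by simp
        ultimately show ?thesis
          unfolding split by simp
      qed (simp add: outside h h')
    qed
    then show "h = h'" by (intro ext)
  qed
  show ?thesis
  proof (rule groupI)
    fix g :: "('a, 'f) matr"
    assume g: "g \<in> U I P"
    have "(\<lambda>h. mult_matr I h g) ` U I P = U I P"
      by (rule endo_inj_surj[OF finite_U[OF fin po] _ inj[OF g]]) (auto intro: closed g)
    with one have "(id_matr I :: ('a, 'f) matr) \<in> (\<lambda>h. mult_matr I h g) ` U I P"
      by simp
    then show "\<exists>h\<in>U I P. h \<otimes>\<^bsub>?G\<^esub> g = \<one>\<^bsub>?G\<^esub>"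
      by (auto simp: m o)
  qed (auto simp: m o closed one assoc l_one)
qed

subsection \<open>Labeled set partitions\<close>

text \<open>The triple \<open>(i, a, j)\<close> is the arc from \<open>i\<close> to \<open>j\<close> with label \<open>a\<close>.\<close>

type_synonym ('a, 'f) arc = "'a \<times> 'f \<times> 'a"

definition is_set_partition :: "'a rel \<Rightarrow> ('a, 'f::field) arc set \<Rightarrow> bool" where
  "is_set_partition P \<eta> \<longleftrightarrow>
     (\<forall>i a j. (i, a, j) \<in> \<eta> \<longrightarrow> a \<noteq> 0) \<and>
     (\<forall>i a b j. (i, a, j) \<in> \<eta> \<and> (i, b, j) \<in> \<eta> \<longrightarrow> a = b) \<and>
     (\<forall>i a j. (i, a, j) \<in> \<eta> \<longrightarrow> prec P i j) \<and>
     (\<forall>i a j k. (i, a, j) \<in> \<eta> \<and> prec P i k \<and> prec P k j \<longrightarrow>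
        (\<forall>b. (i, b, k) \<notin> \<eta>) \<and> (\<forall>b. (k, b, j) \<notin> \<eta>))"

definition nonnesting :: "'a rel \<Rightarrow> ('a, 'f::field) arc set \<Rightarrow> bool" where
  "nonnesting P \<eta> \<longleftrightarrow>
     \<not> (\<exists>i a j k b l. (i, a, j) \<in> \<eta> \<and> (k, b, l) \<in> \<eta> \<and> prec P i k \<and> prec P k l \<and> prec P l j)"

definition NN :: "'a rel \<Rightarrow> ('a, 'f::field) arc set set" where
  "NN P = {\<eta>. is_set_partition P \<eta> \<and> nonnesting P \<eta>}"

lemma finite_NN:
  assumes "finite I" "partial_order_on I P"
  shows "finite (NN P :: ('a, 'f::{field,finite}) arc set set)"
proof (rule finite_subset)
  have "P \<subseteq> I \<times> I"
    using assms by (auto simp: partial_order_on_def preorder_on_def)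
  then have "x \<in> I \<times> UNIV \<times> I" if "\<eta> \<in> NN P" "x \<in> \<eta>" for x and \<eta> :: "('a, 'f) arc set"
    using that unfolding NN_def is_set_partition_def prec_def by (cases x) blast
  then show "(NN P :: ('a, 'f) arc set set) \<subseteq> Pow (I \<times> UNIV \<times> I)"
    by blast
  show "finite (Pow (I \<times> (UNIV :: 'f set) \<times> I))"
    using assms(1) by simp
qed

lemma is_set_partition_Un:
  assumes "S \<inter> T = {}"
    and "is_set_partition (Restr P S) \<nu>" "is_set_partition (Restr P T) \<rho>"
  shows "is_set_partition P (\<nu> \<union> \<rho>)"
proof -
  have *: "a \<noteq> 0 \<and> prec P i j \<and> i \<in> A \<and> j \<in> A \<and> ((i, b, j) \<in> \<mu> \<longrightarrow> a = b) \<and>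
      (prec P i k \<and> prec P k j \<longrightarrow> (i, b, k) \<notin> \<mu> \<and> (k, b, j) \<notin> \<mu>)"
    if \<mu>: "is_set_partition (Restr P A) \<mu>" "(i, a, j) \<in> \<mu>"
    for A and \<mu> and i j k a b
  proof -
    have arc: "x \<in> A \<and> y \<in> A \<and> prec P x y" if "(x, c, y) \<in> \<mu>" for x y c
      using \<mu>(1) that unfolding is_set_partition_def prec_def by blast
    have "(i, b, k) \<notin> \<mu> \<and> (k, b, j) \<notin> \<mu>" if "prec P i k" "prec P k j"
    proof (rule ccontr)
      assume "\<not> ?thesis"
      then have "k \<in> A"
        using arc by blast
      then have "prec (Restr P A) i k" "prec (Restr P A) k j"
        using that arc[OF \<mu>(2)] by (auto simp: prec_def)
      with \<open>\<not> ?thesis\<close> show False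
        using \<mu> unfolding is_set_partition_def by blast
    qed
    moreover have "a \<noteq> 0" "(i, b, j) \<in> \<mu> \<Longrightarrow> a = b"
      using \<mu> unfolding is_set_partition_def by blast+
    ultimately show ?thesis
      using arc[OF \<mu>(2)] by blast
  qed
  have in_S: "x \<in> S \<and> y \<in> S \<and> x \<notin> T \<and> y \<notin> T" if "(x, c, y) \<in> \<nu>" for x c y
    using *[OF assms(2) that, of c] assms(1) by blast
  have in_T: "x \<in> T \<and> y \<in> T \<and> x \<notin> S \<and> y \<notin> S" if "(x, c, y) \<in> \<rho>" for x c y
    using *[OF assms(3) that, of c] assms(1) by blast
  have main: "a \<noteq> 0 \<and> prec P i j \<and> ((i, b, j) \<in> \<nu> \<union> \<rho> \<longrightarrow> a = b) \<and>
      (prec P i k \<and> prec P k j \<longrightarrow> (i, b, k) \<notin> \<nu> \<union> \<rho> \<and> (k, b, j) \<notin> \<nu> \<union> \<rho>)"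
    if "(i, a, j) \<in> \<nu> \<union> \<rho>" for i a j b k
    using that
  proof
    assume "(i, a, j) \<in> \<nu>"
    with in_S[OF this] *[OF assms(2) this, of b k] show ?thesis
      by (auto dest: in_T)
  next
    assume "(i, a, j) \<in> \<rho>"
    with in_T[OF this] *[OF assms(3) this, of b k] show ?thesis
      by (auto dest: in_S)
  qed
  show ?thesis
    unfolding is_set_partition_def
  proof (intro conjI allI impI)
    fix i a j assume "(i, a, j) \<in> \<nu> \<union> \<rho>"
    from main[OF this] show "a \<noteq> 0" "prec P i j"
      by simp_all
  next
    fix i a b j assume "(i, a, j) \<in> \<nu> \<union> \<rho> \<and> (i, b, j) \<in> \<nu> \<union> \<rho>"
    then show "a = b"
      using main[of i a j b] by blast
  next
    fix i a j k b assume "(i, a, j) \<in> \<nu> \<union> \<rho> \<and> prec P i k \<and> prec P k j"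
    with main[of i a j b k] show "(i, b, k) \<notin> \<nu> \<union> \<rho>" "(k, b, j) \<notin> \<nu> \<union> \<rho>"
      by simp_all
  qed
qed

definition sml :: "'a rel \<Rightarrow> ('a, 'f::field) arc set \<Rightarrow> ('a, 'f) arc set" where
  "sml P \<eta> = {(i, a, j). (i, a, j) \<in> \<eta> \<and>
     \<not> (\<exists>k b l. (k, b, l) \<in> \<eta> \<and> prec P i k \<and> prec P k l \<and> prec P l j)}"

definition sml_matr :: "'a rel \<Rightarrow> ('a, 'f::field) matr \<Rightarrow> ('a, 'f) arc set" where
  "sml_matr P g = {(i, a, j). prec P i j \<and> a = g i j \<and> g i j \<noteq> 0 \<and>
     (\<forall>k l. (k, l) \<noteq> (i, j) \<and> (i, k) \<in> P \<and> prec P k l \<and> (l, j) \<in> P \<longrightarrow> g k l = 0)}"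

subsection \<open>Functions on pattern groups\<close>

text \<open>A complex function on a finite set \<open>X\<close> is represented by its extension by zero to the whole
  type; sums of functions are pointwise.\<close>

definition K :: "'a set \<Rightarrow> 'a rel \<Rightarrow> ('a, 'f::field) arc set \<Rightarrow> ('a, 'f) matr set" where
  "K I P \<eta> = {g \<in> U I P. sml_matr P g = \<eta>}"

definition kappa :: "'a set \<Rightarrow> 'a rel \<Rightarrow> ('a, 'f::field) arc set \<Rightarrow> ('a, 'f) matr \<Rightarrow> complex" where
  "kappa I P \<eta> = indicator (K I P \<eta>)"

text \<open>An element of the tensor product of the spaces of functions on \<open>X\<close> and \<open>Y\<close> is identified with
  a function on \<open>X \<times> Y\<close>.\<close>

definition tensor :: "('x \<Rightarrow> complex) \<Rightarrow> ('y \<Rightarrow> complex) \<Rightarrow> 'x \<times> 'y \<Rightarrow> complex" where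
  "tensor \<alpha> \<beta> = (\<lambda>(g, h). \<alpha> g * \<beta> h)"

definition sigma :: "'a set \<Rightarrow> 'a set \<Rightarrow> ('a, 'f::field) matr \<times> ('a, 'f) matr \<Rightarrow> ('a, 'f) matr" where
  "sigma S T = (\<lambda>(g, h) i j.
     if i \<in> S \<and> j \<in> S then g i j else if i \<in> T \<and> j \<in> T then h i j else 0)"

lemma sigma_in_U:
  assumes "partial_order_on I P" "S \<union> T = I" "S \<inter> T = {}"
    and "g \<in> U S (Restr P S)" "h \<in> U T (Restr P T)"
  shows "sigma S T (g, h) \<in> U I P"
proof -
  have po: "partial_order_on A (Restr P A)" if "A \<subseteq> I" for A
    using assms(1) that
    by (auto simp: partial_order_on_def preorder_on_def refl_on_def trans_def antisym_def)
  have "partial_order_on S (Restr P S)" "partial_order_on T (Restr P T)"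
    using po assms(2) by auto
  with assms show ?thesis
    by (auto simp: mem_U_iff sigma_def)
qed

text \<open>The restriction to the domain of \<open>\<sigma>\<close> is the extension-by-zero convention.\<close>

definition Delta ::
    "'a rel \<Rightarrow> 'a set \<Rightarrow> 'a set \<Rightarrow> (('a, 'f::field) matr \<Rightarrow> complex) \<Rightarrow>
     ('a, 'f) matr \<times> ('a, 'f) matr \<Rightarrow> complex" where
  "Delta P S T \<alpha> = (\<lambda>x.
     if x \<in> U S (Restr P S) \<times> U T (Restr P T) then (\<alpha> \<circ> sigma S T) x else 0)"

end

theory Submission
  imports Defs
begin

text \<open>
  The entries of \<open>\<sigma>(g, h)\<close> indexed by \<open>S \<times> T\<close> and \<open>T \<times> S\<close> vanish, and below every nonzero entry of a
  matrix lies a minimal one. Hence the arcs of \<open>sml(\<sigma>(g, h))\<close> are the arcs of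
  \<open>sml(g) \<squnion> sml(h)\<close> that do not strictly contain another such arc, that is,
  \<open>sml(\<sigma>(g, h)) = sml(sml(g) \<squnion> sml(h))\<close>. At \<open>(g, h)\<close> the only term of the sum that can be nonzero
  is the one with \<open>\<nu> = sml(g)\<close> and \<open>\<rho> = sml(h)\<close>.
\<close>

lemma partial_order_on_Restr:
  assumes "partial_order_on I P" "A \<subseteq> I"
  shows "partial_order_on A (Restr P A)"
  using assms by (auto simp: partial_order_on_def preorder_on_def refl_on_def trans_def antisym_def)

lemma mem_sml_matr_iff:
  "(i, a, j) \<in> sml_matr P g \<longleftrightarrow> prec P i j \<and> a = g i j \<and> g i j \<noteq> 0 \<and>
     (\<forall>k l. (k, l) \<noteq> (i, j) \<and> (i, k) \<in> P \<and> prec P k l \<and> (l, j) \<in> P \<longrightarrow> g k l = 0)"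
  by (simp add: sml_matr_def)

text \<open>An arc of \<open>sml_matr P g\<close> forces every other entry weakly inside it to
  vanish. Sharing an endpoint with an inner arc and strict nesting are both special cases of lying
  weakly inside, and labels are unique because they are entries of \<open>g\<close>.\<close>

lemma sml_matr_in_NN:
  assumes "partial_order_on I P"
  shows "sml_matr P g \<in> NN P"
proof -
  have re: "(i, i) \<in> P \<and> (j, j) \<in> P" if "prec P i j" for i j
    using assms that by (auto simp: prec_def partial_order_on_def preorder_on_def refl_on_def)
  have "is_set_partition P (sml_matr P g)"
    unfolding is_set_partition_def mem_sml_matr_iff
    using re by (auto simp: prec_def)
  moreover have "nonnesting P (sml_matr P g)"
    unfolding nonnesting_def mem_sml_matr_iff
    using assms by (auto simp: prec_def partial_order_on_def antisym_def)
  ultimately show ?thesis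
    by (simp add: NN_def)
qed

text \<open>Induction on the size of the interval from \<open>i\<close> to \<open>j\<close>: if the
  entry is not minimal, some other nonzero entry sits weakly inside, and its interval is strictly
  smaller.\<close>

lemma sml_matr_below:
  assumes "finite I" "partial_order_on I P"
    and "prec P i j" "g i j \<noteq> 0"
  shows "\<exists>k l. (k, g k l, l) \<in> sml_matr P g \<and> (i, k) \<in> P \<and> (l, j) \<in> P"
  using assms(3,4)
proof (induction "card {m. (i, m) \<in> P \<and> (m, j) \<in> P}" arbitrary: i j rule: less_induct)
  case less
  have sub: "P \<subseteq> I \<times> I" and tr: "\<And>i j k. (i, j) \<in> P \<Longrightarrow> (j, k) \<in> P \<Longrightarrow> (i, k) \<in> P"
    and an: "\<And>i j. (i, j) \<in> P \<Longrightarrow> (j, i) \<in> P \<Longrightarrow> i = j"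
    and re: "\<And>i. i \<in> I \<Longrightarrow> (i, i) \<in> P"
    using assms(2) by (auto simp: partial_order_on_def preorder_on_def trans_def antisym_def refl_on_def)
  have ij: "(i, i) \<in> P" "(j, j) \<in> P" "(i, j) \<in> P"
    using less.prems sub re by (auto simp: prec_def)
  show ?case
  proof (cases "(i, g i j, j) \<in> sml_matr P g")
    case True
    with ij show ?thesis by blast
  next
    case False
    with less.prems obtain k l where kl: "(k, l) \<noteq> (i, j)" "(i, k) \<in> P" "prec P k l" "(l, j) \<in> P"
      "g k l \<noteq> 0"
      by (auto simp: mem_sml_matr_iff)
    have "{m. (k, m) \<in> P \<and> (m, l) \<in> P} \<subset> {m. (i, m) \<in> P \<and> (m, j) \<in> P}"
    proof
      show "{m. (k, m) \<in> P \<and> (m, l) \<in> P} \<subseteq> {m. (i, m) \<in> P \<and> (m, j) \<in> P}"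
        using kl tr by blast
      \<comment> \<open>If the intervals agreed, \<open>i\<close> and \<open>j\<close> would lie
        between \<open>k\<close> and \<open>l\<close>, and antisymmetry would give
        \<open>(k, l) = (i, j)\<close>.\<close>
      show "{m. (k, m) \<in> P \<and> (m, l) \<in> P} \<noteq> {m. (i, m) \<in> P \<and> (m, j) \<in> P}"
        using kl ij an by blast
    qed
    moreover have "finite {m. (i, m) \<in> P \<and> (m, j) \<in> P}"
      by (rule finite_subset[OF _ assms(1)]) (use sub in auto)
    ultimately have "card {m. (k, m) \<in> P \<and> (m, l) \<in> P} < card {m. (i, m) \<in> P \<and> (m, j) \<in> P}"
      by (rule psubset_card_mono[rotated])
    from less.hyps[OF this kl(3,5)] kl(2,4) tr show ?thesis
      by blast
  qed
qed

text \<open>Lets arcs inside \<open>T\<close> be treated as arcs inside \<open>S\<close> with the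
  two blocks exchanged.\<close>

lemma sigma_commute: "S \<inter> T = {} \<Longrightarrow> sigma S T (g, h) = sigma T S (h, g)"
  by (auto simp: sigma_def fun_eq_iff)

text \<open>A minimal entry of \<open>g\<close> can lose minimality in \<open>P\<close> only through
  a nonzero entry of \<open>h\<close> inside it. Testing the arcs of
  \<open>sml_matr (Restr P T) h\<close> is enough, since \<open>sml_matr_below\<close> finds one
  below each nonzero entry of \<open>h\<close>.\<close>

lemma mem_sml_matr_sigma_iff:
  assumes "finite I" "partial_order_on I P" "S \<union> T = I" "S \<inter> T = {}"
    and ij: "i \<in> S" "j \<in> S"
  shows "(i, a, j) \<in> sml_matr P (sigma S T (g, h)) \<longleftrightarrow>
    (i, a, j) \<in> sml P (sml_matr (Restr P S) g \<union> sml_matr (Restr P T) h)"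
    (is "?L \<longleftrightarrow> ?R")
proof -
  let ?\<nu> = "sml_matr (Restr P S) g" and ?\<rho> = "sml_matr (Restr P T) h"
  have sub: "P \<subseteq> I \<times> I" and tr: "\<And>i j k. (i, j) \<in> P \<Longrightarrow> (j, k) \<in> P \<Longrightarrow> (i, k) \<in> P"
    using assms(2) by (auto simp: partial_order_on_def preorder_on_def trans_def)
  have SS: "sigma S T (g, h) k l = g k l" if "k \<in> S" "l \<in> S" for k l
    using that by (simp add: sigma_def)
  have TT: "sigma S T (g, h) k l = h k l" if "k \<in> T" "l \<in> T" for k l
    using that assms(4) by (auto simp: sigma_def)
  have disj: "x \<notin> T" if "x \<in> S" for x
    using that assms(4) by blast
  have \<nu>D: "k \<in> S \<and> l \<in> S \<and> prec P k l \<and> b = g k l \<and> g k l \<noteq> 0" if "(k, b, l) \<in> ?\<nu>" for k b l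
    using that by (auto simp: mem_sml_matr_iff prec_def)
  have \<rho>D: "k \<in> T \<and> l \<in> T \<and> prec P k l \<and> b = h k l \<and> h k l \<noteq> 0" if "(k, b, l) \<in> ?\<rho>" for k b l
    using that by (auto simp: mem_sml_matr_iff prec_def)
  show ?thesis
  proof
    assume L: ?L
    then have min: "sigma S T (g, h) k l = 0"
      if "(k, l) \<noteq> (i, j)" "(i, k) \<in> P" "prec P k l" "(l, j) \<in> P" for k l
      using that by (auto simp: mem_sml_matr_iff)
    from L ij have "prec P i j" "a = g i j" "g i j \<noteq> 0"
      by (auto simp: mem_sml_matr_iff SS)
    moreover have "g k l = 0"
      if "(k, l) \<noteq> (i, j)" "(i, k) \<in> Restr P S" "prec (Restr P S) k l" "(l, j) \<in> Restr P S" for k l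
      using min[of k l] SS[of k l] that by (auto simp: prec_def)
    ultimately have "(i, a, j) \<in> ?\<nu>"
      using ij by (auto simp: mem_sml_matr_iff prec_def)
    moreover have False
      if kl: "(k, b, l) \<in> ?\<nu> \<union> ?\<rho>" "prec P i k" "prec P k l" "prec P l j" for k b l
    proof -
      have "(l, k) \<notin> P"
        using kl(3) assms(2) by (auto simp: prec_def partial_order_on_def antisym_def)
      with kl have "sigma S T (g, h) k l = 0"
        by (intro min) (auto simp: prec_def)
      with kl(1) show False
        using \<nu>D[of k b l] \<rho>D[of k b l] by (auto simp: SS TT)
    qed
    ultimately show ?R
      unfolding sml_def by blast
  next
    assume ?R
    then have arc: "(i, a, j) \<in> ?\<nu>"
      and no: "\<not> ((k, b, l) \<in> ?\<nu> \<union> ?\<rho> \<and> prec P i k \<and> prec P k l \<and> prec P l j)" for k b l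
      using \<rho>D ij disj unfolding sml_def by blast+
    have "sigma S T (g, h) k l = 0"
      if kl: "(k, l) \<noteq> (i, j)" "(i, k) \<in> P" "prec P k l" "(l, j) \<in> P" for k l
    proof (rule ccontr)
      assume nz: "sigma S T (g, h) k l \<noteq> 0"
      show False
      proof (cases "k \<in> S \<and> l \<in> S")
        case True
        with arc kl ij have "g k l = 0"
          by (auto simp: mem_sml_matr_iff prec_def)
        with nz True show False
          by (simp add: SS)
      next
        case False
        \<comment> \<open>Mixed entries of \<open>sigma\<close> are 0, so a nonzero entry outside
          the \<open>S\<close> block lies in the \<open>T\<close> block.\<close>
        with nz have T: "k \<in> T" "l \<in> T"
          by (auto simp: sigma_def split: if_splits)
        have "finite T" "partial_order_on T (Restr P T)"
          using assms partial_order_on_Restr[of I P T] by auto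
        moreover have "prec (Restr P T) k l" "h k l \<noteq> 0"
          using T kl(3) nz by (auto simp: prec_def TT)
        ultimately obtain k' l' where *: "(k', h k' l', l') \<in> ?\<rho>" "(k, k') \<in> P" "(l', l) \<in> P"
          using sml_matr_below[of T "Restr P T" k l h] by blast
        \<comment> \<open>\<open>k'\<close> and \<open>l'\<close> lie in \<open>T\<close>, so they differ from \<open>i\<close> and \<open>j\<close>: this turns the weak nesting
          in the matrix \<open>sml\<close> into the strict nesting in the set partition \<open>sml\<close>.\<close>
        have "prec P i k'" "prec P l' j"
          using \<rho>D[OF *(1)] ij disj * kl tr by (auto simp: prec_def)
        with no \<rho>D[OF *(1)] *(1) show False
          by blast
      qed
    qed
    moreover have "prec P i j" "a = g i j" "g i j \<noteq> 0"
      using \<nu>D[OF arc] by auto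
    ultimately show ?L
      using ij by (auto simp: mem_sml_matr_iff SS)
  qed
qed

lemma sml_matr_sigma:
  fixes g h :: "('a, 'f::field) matr"
  assumes "finite I" "partial_order_on I P" "S \<union> T = I" "S \<inter> T = {}"
  shows "sml_matr P (sigma S T (g, h)) =
    sml P (sml_matr (Restr P S) g \<union> sml_matr (Restr P T) h)"
proof (rule Set.set_eqI)
  fix x :: "('a, 'f) arc"
  obtain i a j where x: "x = (i, a, j)"
    by (cases x)
  have comm: "T \<union> S = I" "T \<inter> S = {}"
    using assms by auto
  consider "i \<in> S \<and> j \<in> S" | "i \<in> T \<and> j \<in> T" | "\<not> (i \<in> S \<and> j \<in> S)" "\<not> (i \<in> T \<and> j \<in> T)"
    by blast
  then show "x \<in> sml_matr P (sigma S T (g, h)) \<longleftrightarrow>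
    x \<in> sml P (sml_matr (Restr P S) g \<union> sml_matr (Restr P T) h)"
  proof cases
    case 1
    then show ?thesis
      using mem_sml_matr_sigma_iff[OF assms] x by blast
  next
    case 2
    then show ?thesis
      using mem_sml_matr_sigma_iff[OF assms(1,2) comm, of i j a h g] x
      by (simp add: sigma_commute[OF assms(4)] Un_commute)
  next
    \<comment> \<open>Neither side has an arc joining \<open>S\<close> to \<open>T\<close>: the
      entry of \<open>sigma\<close> there is 0, and arcs for \<open>Restr P S\<close> or
      \<open>Restr P T\<close> stay in one block.\<close>
    case 3
    then show ?thesis
      by (auto simp: x sml_def mem_sml_matr_iff sigma_def prec_def)
  qed
qed

lemma sum_fun_apply: "(\<Sum>i\<in>A. f i) x = (\<Sum>i\<in>A. f i x)"
  by (induction A rule: infinite_finite_induct) auto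

theorem proposition8p4:
  fixes P :: "'a rel" and I S T :: "'a set"
    and \<eta> :: "('a, 'f::{field,finite}) arc set"
  assumes "finite I"
    and "partial_order_on I P"
    and "S \<union> T = I" and "S \<inter> T = {}"
    and "\<eta> \<in> NN P"
  shows "Delta P S T (kappa I P \<eta>) =
    (\<Sum>(\<nu>, \<rho>) \<in> {(\<nu>, \<rho>). \<nu> \<in> NN (Restr P S) \<and> \<rho> \<in> NN (Restr P T) \<and> sml P (\<nu> \<union> \<rho>) = \<eta>}.
       tensor (kappa S (Restr P S) \<nu>) (kappa T (Restr P T) \<rho>))"
proof (rule ext)
  fix x :: "('a, 'f) matr \<times> ('a, 'f) matr"
  obtain g h where x: "x = (g, h)"
    by (cases x)
  let ?N = "{(\<nu>, \<rho>). \<nu> \<in> NN (Restr P S) \<and> \<rho> \<in> NN (Restr P T) \<and> sml P (\<nu> \<union> \<rho>) = \<eta>}"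
  let ?\<nu> = "sml_matr (Restr P S) g" and ?\<rho> = "sml_matr (Restr P T) h"
  let ?U = "x \<in> U S (Restr P S) \<times> U T (Restr P T)"
  have po: "partial_order_on S (Restr P S)" "partial_order_on T (Restr P T)"
    using assms partial_order_on_Restr[OF assms(2)] by auto
  have "finite S" "finite T"
    using assms by auto
  then have "finite (NN (Restr P S) \<times> NN (Restr P T) :: (('a, 'f) arc set \<times> ('a, 'f) arc set) set)"
    using po by (intro finite_cartesian_product finite_NN)
  \<comment> \<open>Finiteness is what allows \<open>sum.delta\<close> below; a sum over an infinite
    set would be 0 by convention.\<close>
  then have fin: "finite ?N"
    by (rule rev_finite_subset) auto
  have "(?\<nu>, ?\<rho>) \<in> ?N \<longleftrightarrow> sml_matr P (sigma S T (g, h)) = \<eta>"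
    using po by (simp add: sml_matr_in_NN sml_matr_sigma[OF assms(1-4)])
  \<comment> \<open>The factor \<open>of_bool ?U\<close> records the extension by zero; on the
    domain, \<open>sigma_in_U\<close> reduces membership in \<open>K I P \<eta>\<close> to the
    condition on \<open>sml_matr\<close>.\<close>
  then have "Delta P S T (kappa I P \<eta>) x = (if (?\<nu>, ?\<rho>) \<in> ?N then of_bool ?U else 0)"
    using sigma_in_U[OF assms(2-4)]
    by (auto simp: x Delta_def kappa_def K_def indicator_def)
  \<comment> \<open>The value is spread out as a delta sum so that it can be compared with the
    tensor products term by term.\<close>
  also have "\<dots> = (\<Sum>p\<in>?N. if p = (?\<nu>, ?\<rho>) then of_bool ?U else 0)"
    using fin by (simp only: sum.delta)
  also have "\<dots> = (\<Sum>p\<in>?N. (case p of (\<nu>, \<rho>) \<Rightarrow>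
      tensor (kappa S (Restr P S) \<nu>) (kappa T (Restr P T) \<rho>)) x)"
    by (rule sum.cong) (auto simp: x tensor_def kappa_def K_def indicator_def)
  finally show "Delta P S T (kappa I P \<eta>) x = (\<Sum>(\<nu>, \<rho>) \<in> ?N.
      tensor (kappa S (Restr P S) \<nu>) (kappa T (Restr P T) \<rho>)) x"
    by (simp only: sum_fun_apply)
qed

end
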